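(* Let $m,k$ be integers, let $\Delta=k^2$ be the discriminant of $(m,0,k)$, and let $0\le m<|k|$. (i) The class $C(m,0,k)$ is supersymmetric if and only if $m=0$, or $k$ is even and $m=k/2$ (the discriminant is in this case divisible by 4). (ii) $C(m,0,k)$ is $(m+n)$-symmetric if and only if the even continued fraction of $k/m$ is palindromic. (iii) $C(m,0,k)$ is $k$-symmetric if and only if the odd continued fraction of $k/m$ is palindromic. (iv) The class $C(m,0,k)$ cannot be antisymmetric. (v) $C(m,0,k)$ is asymmetric if and only if neither the odd nor the even continued fraction of $k/m$ is palindromic.
   Context: The triple $\mathbf f=(m,n,k)\in\mathbb{Z}^3$ denotes the binary quadratic form $f(x,y)=mx^2+ny^2+kxy$ of discriminant $k^2-4mn$. The class $C(\mathbf f)=C(m,n,k)$ is the orbit of $\mathbf f$ under the action of $\mathrm{SL}(2,\mathbb{Z})$ by linear changes of the variables $(x,y)$. For $\mathbf f=(m,n,k)$ define the conjugate $\overline{\mathbf f}=(m,n,-k)$, the adjoint $\mathbf f^*=(-n,-m,k)$ and the antipodal $\overline{\mathbf f}^*=(-n,-m,-k)$. If a class contains one form together with its image under one of these involutions, the whole class is invariant under that involution. A class is: asymmetric if invariant under none of the three; $k$-symmetric if invariant under conjugation only; $(m+n)$-symmetric if invariant under the adjoint involution only; antisymmetric if invariant under the antipodal involution only; supersymmetric if invariant under all three. For a rational number $r>1$ let $[a_1,\dots,a_N]$ be its finite regular continued fraction $a_1+\frac{1}{a_2+\cdots}$ with last element $a_N>1$. The even (respectively odd) continued fraction of $r$ is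 $[a_1,\dots,a_N]$ if $N$ is even (respectively odd), and $[a_1,\dots,a_{N-1},a_N-1,1]$ otherwise. A finite continued fraction $[a_1,\dots,a_L]$ is palindromic if $a_i=a_{L+1-i}$ for all $i$.
   Formalization: k/m and k/2 are read as |k|/m and |k|/2, since (i) fails at (m,k)=(1,-2); (ii), (iii), (v) assume m≠0, as k/m is otherwise undefined; (ii), (iii) also exclude 2m=|k|, where the class is supersymmetric although both continued fractions of 2 are palindromic. *)

theory Defs
  imports Complex_Main
begin

text \<open>A triple \<open>(m, n, k)\<close> stands for the form $m x^2 + n y^2 + k x y$; the coefficient
  of the mixed term comes last.\<close>

type_synonym bqf = "int \<times> int \<times> int"

fun bqf_eval :: "bqf \<Rightarrow> int \<Rightarrow> int \<Rightarrow> int" where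
  "bqf_eval (m, n, k) x y = m * x\<^sup>2 + n * y\<^sup>2 + k * x * y"

fun disc :: "bqf \<Rightarrow> int" where
  "disc (m, n, k) = k\<^sup>2 - 4 * m * n"

text \<open>The orbit under \<open>SL(2, \<int>)\<close>. Equality of forms as polynomials is expressed by equality of
  their values at all integer points, which determines the three coefficients.\<close>

definition form_class :: "bqf \<Rightarrow> bqf set" where
  "form_class f = {g. \<exists>a b c d. a * d - b * c = 1 \<and>
     (\<forall>x y. bqf_eval g x y = bqf_eval f (a * x + b * y) (c * x + d * y))}"

fun conjugate :: "bqf \<Rightarrow> bqf" where
  "conjugate (m, n, k) = (m, n, - k)"

fun adjoint :: "bqf \<Rightarrow> bqf" where
  "adjoint (m, n, k) = (- n, - m, k)"

fun antipodal :: "bqf \<Rightarrow> bqf" where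
  "antipodal (m, n, k) = (- n, - m, - k)"

definition invariant_under :: "(bqf \<Rightarrow> bqf) \<Rightarrow> bqf set \<Rightarrow> bool" where
  "invariant_under \<sigma> C \<longleftrightarrow> \<sigma> ` C = C"

definition asymmetric :: "bqf set \<Rightarrow> bool" where
  "asymmetric C \<longleftrightarrow> \<not> invariant_under conjugate C \<and>
     \<not> invariant_under adjoint C \<and> \<not> invariant_under antipodal C"

definition k_symmetric :: "bqf set \<Rightarrow> bool" where
  "k_symmetric C \<longleftrightarrow> invariant_under conjugate C \<and>
     \<not> invariant_under adjoint C \<and> \<not> invariant_under antipodal C"

definition mn_symmetric :: "bqf set \<Rightarrow> bool" where
  "mn_symmetric C \<longleftrightarrow> \<not> invariant_under conjugate C \<and>
     invariant_under adjoint C \<and> \<not> invariant_under antipodal C"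

definition antisymmetric :: "bqf set \<Rightarrow> bool" where
  "antisymmetric C \<longleftrightarrow> \<not> invariant_under conjugate C \<and>
     \<not> invariant_under adjoint C \<and> invariant_under antipodal C"

definition supersymmetric :: "bqf set \<Rightarrow> bool" where
  "supersymmetric C \<longleftrightarrow> invariant_under conjugate C \<and>
     invariant_under adjoint C \<and> invariant_under antipodal C"

text \<open>The value at the empty list is a dummy.\<close>

fun cf_value :: "nat list \<Rightarrow> rat" where
  "cf_value [] = 0"
| "cf_value [a] = of_nat a"
| "cf_value (a # b # as) = of_nat a + 1 / cf_value (b # as)"

text \<open>For every rational \<open>r > 1\<close> there is exactly one such list. For other \<open>r\<close> the following three
  definitions are not meant to be used.\<close>

definition regular_cf :: "rat \<Rightarrow> nat list" where
  "regular_cf r = (THE as. as \<noteq> [] \<and> (\<forall>a \<in> set as. 0 < a) \<and> 1 < last as \<and> cf_value as = r)"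

definition even_cf :: "rat \<Rightarrow> nat list" where
  "even_cf r = (let as = regular_cf r in
     if even (length as) then as else butlast as @ [last as - 1, 1])"

definition odd_cf :: "rat \<Rightarrow> nat list" where
  "odd_cf r = (let as = regular_cf r in
     if odd (length as) then as else butlast as @ [last as - 1, 1])"

definition palindromic :: "nat list \<Rightarrow> bool" where
  "palindromic as \<longleftrightarrow> (\<forall>i < length as. as ! i = as ! (length as - 1 - i))"

end

theory Submission
  imports Defs
begin

text \<open>The form \<open>(m, 0, k)\<close> factors as \<open>x (m x + k y)\<close>; for \<open>k \<noteq> 0\<close> it vanishes on exactly
  two lines. A change of basis that leads to another form with vanishing second coefficient has to send the
  second basis vector to a primitive vector on one of these lines. Write \<open>m = g M\<close> and
  \<open>k = g P\<close> with \<open>M\<close> and \<open>P\<close> coprime. If the line \<open>x = 0\<close> is kept, then \<open>k\<close> keeps its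
  sign and \<open>m\<close> changes by a multiple of \<open>k\<close> (\<open>shift_mem_form_class_iff\<close>); if the lines are
  exchanged, then \<open>k\<close> changes sign and \<open>M\<close> is replaced by an inverse of \<open>M\<close> modulo \<open>P\<close>
  (\<open>inverse_mem_form_class_iff\<close>). The conjugate of the form is \<open>(m, 0, - k)\<close>, while its adjoint
  \<open>(0, - m, k)\<close> and its antipodal form \<open>(0, - m, - k)\<close> are equivalent to \<open>(- m, 0, - k)\<close> and
  \<open>(- m, 0, k)\<close> by the substitution of \<open>(y, - x)\<close> for \<open>(x, y)\<close>.
  Hence the class is invariant under conjugation iff \<open>M\<^sup>2 \<equiv> 1\<close>, under the adjoint iff \<open>M\<^sup>2 \<equiv> -1\<close>, and under the antipodal
  involution iff \<open>2 M \<equiv> 0\<close>, that is \<open>2 \<equiv> 0\<close>, all modulo \<open>P\<close>. The last condition means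
  \<open>m = 0\<close> or \<open>2 m = \<bar>k\<bar>\<close>, and in these cases the other two hold as well; conversely, the
  first two together give \<open>2 \<equiv> 0\<close>.

  The link with continued fractions is classical. If \<open>[a\<^sub>1, \<dots>, a\<^sub>L]\<close> has value
  \<open>\<bar>P\<bar> / M\<close>, then numerator and denominator are the continuants of \<open>a\<^sub>1, \<dots>, a\<^sub>L\<close> and of
  \<open>a\<^sub>2, \<dots>, a\<^sub>L\<close>. Continuants do not change under reversal, so the reversed expansion has value
  \<open>\<bar>P\<bar> / R\<close>, where \<open>R\<close> is the continuant of \<open>a\<^sub>1, \<dots>, a\<^sub>L\<^sub>-\<^sub>1\<close>, and the determinant
  identity gives \<open>M R \<equiv> - (-1)\<^sup>L\<close> modulo \<open>P\<close>. The expansion is a palindrome iff \<open>R = M\<close>, that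
  is, iff \<open>M\<^sup>2 \<equiv> - (-1)\<^sup>L\<close> (\<open>palindromic_iff_dvd\<close>). Thus even palindromes match the adjoint
  condition and odd ones the condition for conjugation.\<close>

section \<open>Classes of forms and their involutions\<close>

lemma mem_form_class_iff:
  "g \<in> form_class (m, n, k) \<longleftrightarrow> (\<exists>a b c d. a * d - b * c = 1 \<and>
     g = (m * a\<^sup>2 + n * c\<^sup>2 + k * a * c, m * b\<^sup>2 + n * d\<^sup>2 + k * b * d,
          2 * m * a * b + 2 * n * c * d + k * (a * d + b * c)))"
proof -
  obtain p q r where g: "g = (p, q, r)" by (cases g) auto
  have "(\<forall>x y. bqf_eval g x y = bqf_eval (m, n, k) (a * x + b * y) (c * x + d * y)) \<longleftrightarrow>
     g = (m * a\<^sup>2 + n * c\<^sup>2 + k * a * c, m * b\<^sup>2 + n * d\<^sup>2 + k * b * d,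
          2 * m * a * b + 2 * n * c * d + k * (a * d + b * c))" (is "?L \<longleftrightarrow> ?R") for a b c d
  proof
    assume L: ?L
    \<comment> \<open>The values at \<open>(1, 0)\<close>, \<open>(0, 1)\<close> and \<open>(1, 1)\<close> determine the three coefficients.\<close>
    from L[rule_format, of 1 0] L[rule_format, of 0 1] L[rule_format, of 1 1]
    show ?R by (simp add: g power2_eq_square algebra_simps)
  next
    assume ?R
    then show ?L by (simp add: power2_eq_square algebra_simps)
  qed
  then show ?thesis by (simp add: form_class_def)
qed

lemma form_class_refl: "f \<in> form_class f"
  unfolding form_class_def
  by (rule CollectI, rule exI[of _ 1], rule exI[of _ 0], rule exI[of _ 0], rule exI[of _ 1]) simp

lemma form_class_trans:
  assumes "h \<in> form_class g" and "g \<in> form_class f"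
  shows "h \<in> form_class f"
proof -
  obtain a b c d where 1: "a * d - b * c = 1"
      "\<And>x y. bqf_eval h x y = bqf_eval g (a * x + b * y) (c * x + d * y)"
    using assms(1) by (auto simp: form_class_def)
  obtain a' b' c' d' where 2: "a' * d' - b' * c' = 1"
      "\<And>x y. bqf_eval g x y = bqf_eval f (a' * x + b' * y) (c' * x + d' * y)"
    using assms(2) by (auto simp: form_class_def)
  have "(a' * a + b' * c) * (c' * b + d' * d) - (a' * b + b' * d) * (c' * a + d' * c)
      = (a' * d' - b' * c') * (a * d - b * c)"
    by algebra
  then have "(a' * a + b' * c) * (c' * b + d' * d) - (a' * b + b' * d) * (c' * a + d' * c) = 1"
    using 1 2 by simp
  moreover have "bqf_eval h x y = bqf_eval f ((a' * a + b' * c) * x + (a' * b + b' * d) * y)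
      ((c' * a + d' * c) * x + (c' * b + d' * d) * y)" for x y
    by (simp add: 1 2 algebra_simps)
  ultimately show ?thesis unfolding form_class_def by blast
qed

lemma swap_mem_form_class: "(n, m, - k) \<in> form_class (m, n, k)"
  unfolding mem_form_class_iff
  by (rule exI[of _ 0], rule exI[of _ 1], rule exI[of _ "-1"], rule exI[of _ 0]) simp

lemma swap_mem_form_class_iff:
  "(n, m, - k) \<in> form_class f \<longleftrightarrow> (m, n, k) \<in> form_class f"
  using form_class_trans[OF swap_mem_form_class[of n m k]]
    form_class_trans[OF swap_mem_form_class[of m n "- k"]]
  by (metis minus_minus)

text \<open>Each involution composes a form with a signed permutation of the variables and possibly
  negates it. Conjugating a unimodular matrix by this permutation keeps the determinant, so
  equivalent forms have equivalent images.\<close>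

lemma conjugate_mem_form_class:
  assumes "h \<in> form_class g"
  shows "conjugate h \<in> form_class (conjugate g)"
proof -
  have eval: "bqf_eval (conjugate f) x y = bqf_eval f x (- y)" for f x y
    by (cases f) (simp add: power2_eq_square)
  obtain a b c d where 1: "a * d - b * c = 1"
      "\<And>x y. bqf_eval h x y = bqf_eval g (a * x + b * y) (c * x + d * y)"
    using assms by (auto simp: form_class_def)
  show ?thesis unfolding form_class_def
    by (rule CollectI, rule exI[of _ a], rule exI[of _ "- b"], rule exI[of _ "- c"],
        rule exI[of _ d]) (use 1 in \<open>simp add: eval algebra_simps\<close>)
qed

lemma adjoint_mem_form_class:
  assumes "h \<in> form_class g"
  shows "adjoint h \<in> form_class (adjoint g)"
proof -
  have eval: "bqf_eval (adjoint f) x y = - bqf_eval f y (- x)" for f x y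
    by (cases f) (simp add: power2_eq_square algebra_simps)
  obtain a b c d where 1: "a * d - b * c = 1"
      "\<And>x y. bqf_eval h x y = bqf_eval g (a * x + b * y) (c * x + d * y)"
    using assms by (auto simp: form_class_def)
  show ?thesis unfolding form_class_def
    by (rule CollectI, rule exI[of _ d], rule exI[of _ "- c"], rule exI[of _ "- b"],
        rule exI[of _ a]) (use 1 in \<open>simp add: eval algebra_simps\<close>)
qed

lemma antipodal_eq: "antipodal f = adjoint (conjugate f)"
  by (cases f) simp

lemma antipodal_mem_form_class:
  assumes "h \<in> form_class g"
  shows "antipodal h \<in> form_class (antipodal g)"
  using assms by (simp add: antipodal_eq conjugate_mem_form_class adjoint_mem_form_class)

lemma invariant_under_iff:
  assumes equiv: "\<And>g h. h \<in> form_class g \<Longrightarrow> \<sigma> h \<in> form_class (\<sigma> g)"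
    and invol: "\<And>g. \<sigma> (\<sigma> g) = g"
  shows "invariant_under \<sigma> (form_class f) \<longleftrightarrow> \<sigma> f \<in> form_class f"
proof
  assume "invariant_under \<sigma> (form_class f)"
  then show "\<sigma> f \<in> form_class f"
    unfolding invariant_under_def using form_class_refl by blast
next
  assume f: "\<sigma> f \<in> form_class f"
  have sub: "\<sigma> g \<in> form_class f" if "g \<in> form_class f" for g
    using form_class_trans[OF equiv[OF that] f] .
  then show "invariant_under \<sigma> (form_class f)"
    unfolding invariant_under_def by (metis invol image_eqI image_subsetI subsetI subset_antisym)
qed

section \<open>Forms with vanishing second coefficient\<close>

text \<open>Keeping the sign of \<open>k\<close> forces the line \<open>x = 0\<close> to be fixed, so only shears (up to sign)
  are possible.\<close>

lemma shift_mem_form_class_iff: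
  fixes m m' k :: int
  assumes "k \<noteq> 0"
  shows "(m', 0, k) \<in> form_class (m, 0, k) \<longleftrightarrow> k dvd m' - m"
proof
  assume "(m', 0, k) \<in> form_class (m, 0, k)"
  then obtain a b c d where det: "a * d - b * c = 1"
    and m': "m' = m * a\<^sup>2 + k * a * c" and z: "0 = m * b\<^sup>2 + k * b * d"
    and k: "k = 2 * m * a * b + k * (a * d + b * c)"
    by (auto simp: mem_form_class_iff)
  have "b = 0"
  proof (rule ccontr)
    assume "b \<noteq> 0"
    moreover have "b * (m * b + k * d) = 0" using z by algebra
    ultimately have "m * b + k * d = 0" by simp
    then have "k = - k * (a * d - b * c)" using k by algebra
    then show False using det assms by simp
  qed
  then have "a * d = 1" using det by simp
  then have "a\<^sup>2 = 1" by (auto simp: zmult_eq_1_iff)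
  then have "m' - m = k * (a * c)" using m' by simp
  then show "k dvd m' - m" by simp
next
  assume "k dvd m' - m"
  then obtain t where t: "m' = m + k * t" by (metis dvdE diff_eq_eq add.commute)
  show "(m', 0, k) \<in> form_class (m, 0, k)"
    unfolding mem_form_class_iff
    by (rule exI[of _ 1], rule exI[of _ 0], rule exI[of _ t], rule exI[of _ 1]) (simp add: t)
qed

text \<open>Reversing the sign of \<open>k\<close> forces the two isotropic lines to be exchanged: the second basis
  vector has to be \<open>\<plusminus> (P, - M)\<close>. Completing it to a basis of determinant one amounts to solving
  \<open>a M + c P = \<plusminus> 1\<close>, and the new first coefficient is then \<open>\<plusminus> g a\<close>.\<close>

lemma inverse_mem_form_class_iff:
  fixes g M M' P :: int
  assumes cop: "coprime M P" and nz: "g \<noteq> 0" "P \<noteq> 0"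
  shows "(g * M', 0, - (g * P)) \<in> form_class (g * M, 0, g * P) \<longleftrightarrow> P dvd M * M' - 1"
proof
  assume "(g * M', 0, - (g * P)) \<in> form_class (g * M, 0, g * P)"
  then obtain a b c d where det: "a * d - b * c = 1"
    and m': "g * M' = g * M * a\<^sup>2 + g * P * a * c" and z: "0 = g * M * b\<^sup>2 + g * P * b * d"
    and k: "- (g * P) = 2 * (g * M) * a * b + g * P * (a * d + b * c)"
    by (auto simp: mem_form_class_iff)
  define u where "u = a * M + c * P"
  have "b \<noteq> 0"
  proof
    assume "b = 0"
    then have "- (g * P) = g * P" using k det by simp
    then show False using nz by simp
  qed
  moreover have "(g * b) * (M * b + P * d) = 0" using z by algebra
  ultimately have line: "M * b + P * d = 0" using nz by simp
  have "M = d * u" "P = - b * u" unfolding u_def using det line by algebra+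
  then have "u dvd 1" using cop by (metis coprime_common_divisor dvd_triv_right)
  then have u: "u * u = 1" by (metis abs_mult_self_eq mult_1 zdvd1_eq)
  have "g * M' = g * (a * u)" using m' unfolding u_def by algebra
  then have "M' = a * u" using nz by simp
  then have "M * M' - 1 = P * (- u * c)" using u unfolding u_def by algebra
  then show "P dvd M * M' - 1" by simp
next
  assume "P dvd M * M' - 1"
  then obtain t where t: "M * M' - 1 = P * t" by (rule dvdE)
  have "M' * M - (- P) * (- t) = 1" using t by algebra
  moreover have "g * M' = g * M * M'\<^sup>2 + 0 * (- t)\<^sup>2 + g * P * M' * (- t)" using t by algebra
  moreover have "0 = g * M * (- P)\<^sup>2 + 0 * M\<^sup>2 + g * P * (- P) * M" by algebra
  moreover have "- (g * P) = 2 * (g * M) * M' * (- P) + 2 * 0 * (- t) * M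
      + g * P * (M' * M + (- P) * (- t))" using t by algebra
  ultimately show "(g * M', 0, - (g * P)) \<in> form_class (g * M, 0, g * P)"
    unfolding mem_form_class_iff by blast
qed

lemma invariant_conjugate_iff:
  fixes g M P :: int
  assumes "coprime M P" "g \<noteq> 0" "P \<noteq> 0"
  shows "invariant_under conjugate (form_class (g * M, 0, g * P)) \<longleftrightarrow> P dvd M\<^sup>2 - 1"
proof -
  have "conjugate (conjugate f) = f" for f by (cases f) simp
  then show ?thesis
    using inverse_mem_form_class_iff[OF assms, of M]
    by (simp add: invariant_under_iff conjugate_mem_form_class power2_eq_square)
qed

lemma invariant_adjoint_iff:
  fixes g M P :: int
  assumes "coprime M P" "g \<noteq> 0" "P \<noteq> 0"
  shows "invariant_under adjoint (form_class (g * M, 0, g * P)) \<longleftrightarrow> P dvd M\<^sup>2 + 1"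
proof -
  have invol: "adjoint (adjoint f) = f" for f by (cases f) simp
  have "M * (- M) - 1 = - (M\<^sup>2 + 1)" by (simp add: power2_eq_square)
  then have "P dvd M * (- M) - 1 \<longleftrightarrow> P dvd M\<^sup>2 + 1" by (metis dvd_minus_iff)
  then show ?thesis
    using inverse_mem_form_class_iff[OF assms, of "- M"]
      swap_mem_form_class_iff[of "- (g * M)" 0 "g * P" "(g * M, 0, g * P)"]
    by (simp add: invariant_under_iff adjoint_mem_form_class invol)
qed

lemma invariant_antipodal_iff:
  fixes g M P :: int
  assumes "coprime M P" "g \<noteq> 0" "P \<noteq> 0"
  shows "invariant_under antipodal (form_class (g * M, 0, g * P)) \<longleftrightarrow> P dvd 2"
proof -
  have invol: "antipodal (antipodal f) = f" for f by (cases f) simp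
  have "g * P dvd - (g * M) - g * M \<longleftrightarrow> g * P dvd - (g * (M * 2))" by (simp add: algebra_simps)
  also have "\<dots> \<longleftrightarrow> P dvd 2"
    using assms by (simp add: coprime_commute coprime_dvd_mult_right_iff)
  finally show ?thesis
    using shift_mem_form_class_iff[of "g * P" "- (g * M)" "g * M"] assms
      swap_mem_form_class_iff[of "- (g * M)" 0 "- (g * P)" "(g * M, 0, g * P)"]
    by (simp add: invariant_under_iff antipodal_mem_form_class invol)
qed

section \<open>Continuants\<close>

fun continuant :: "nat list \<Rightarrow> nat" where
  "continuant [] = 1"
| "continuant [a] = a"
| "continuant (a # b # as) = a * continuant (b # as) + continuant as"

lemma continuant_snoc:
  "continuant (as @ [b, a]) = a * continuant (as @ [b]) + continuant as"
  by (induction as rule: continuant.induct) (auto simp: algebra_simps)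

text \<open>The defining recursion peels off entries at the front and \<open>continuant_snoc\<close> is the same
  recursion at the end.\<close>

lemma continuant_rev: "continuant (rev as) = continuant as"
proof (induction as rule: continuant.induct)
  case (3 a b as)
  then show ?case using continuant_snoc[of "rev as" b a] by simp
qed simp_all

lemma continuant_det:
  "int (continuant (a # as @ [b])) * int (continuant as)
     - int (continuant (a # as)) * int (continuant (as @ [b])) = (-1) ^ length as"
proof (induction as arbitrary: a)
  case (Cons c as)
  have "int (continuant (a # (c # as) @ [b])) * int (continuant (c # as))
     - int (continuant (a # c # as)) * int (continuant ((c # as) @ [b]))
    = - (int (continuant (c # as @ [b])) * int (continuant as)
     - int (continuant (c # as)) * int (continuant (as @ [b])))"
    by (simp add: algebra_simps)
  then show ?case using Cons.IH[of c] by simp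
qed simp

lemma continuant_pos: "\<forall>a\<in>set as. 0 < a \<Longrightarrow> 0 < continuant as"
  by (induction as rule: continuant.induct) auto

lemma continuant_le_Cons: "0 < a \<Longrightarrow> continuant as \<le> continuant (a # as)"
  by (cases as) (auto intro: trans_le_add1)

lemma coprime_continuant: "coprime (continuant (a # as)) (continuant as)"
proof (induction as arbitrary: a)
  case (Cons b as)
  have "gcd (a * continuant (b # as) + continuant as) (continuant (b # as))
      = gcd (continuant as) (continuant (b # as))"
    by (metis add.commute gcd.commute gcd_add_mult mult.commute)
  then show ?case using Cons[of b] by (simp add: coprime_iff_gcd_eq_1 gcd.commute)
qed simp

section \<open>Values of continued fractions\<close>

lemma cf_value_eq_continuant:
  assumes "\<forall>x\<in>set (a # as). 0 < x"
  shows "cf_value (a # as) = of_nat (continuant (a # as)) / of_nat (continuant as)"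
  using assms
proof (induction as arbitrary: a)
  case (Cons b as)
  have "continuant (b # as) > 0" "continuant as > 0"
    using Cons.prems by (intro continuant_pos; simp)+
  moreover have "cf_value (b # as) = of_nat (continuant (b # as)) / of_nat (continuant as)"
    using Cons by simp
  ultimately show ?case by (simp add: add_divide_distrib)
qed simp

lemma cf_value_ge_1:
  assumes "\<forall>x\<in>set as. 0 < x" "as \<noteq> []"
  shows "1 \<le> cf_value as"
  using assms
proof (induction as rule: cf_value.induct)
  case (3 a b as)
  then have "1 \<le> (of_nat a :: rat)" "0 < 1 / cf_value (b # as)" by auto
  then show ?case unfolding cf_value.simps by linarith
qed simp_all

lemma cf_value_gt_1:
  assumes "\<forall>x\<in>set (a # b # as). 0 < x"
  shows "1 < cf_value (a # b # as)"
proof -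
  have "1 \<le> cf_value (b # as)" using assms by (intro cf_value_ge_1) auto
  then have "0 < 1 / cf_value (b # as)" by simp
  moreover have "1 \<le> (of_nat a :: rat)" using assms by simp
  ultimately show ?thesis unfolding cf_value.simps by linarith
qed

text \<open>For a list of length at least two the first entry is recovered from the value \<open>r\<close> as
  \<open>\<lceil>r\<rceil> - 1\<close>: the rest has value at least one, so that its inverse lies in the interval from 0
  (excluded) to 1 (included). Thus only the end of the list can be ambiguous, and there the
  parity of the length decides.\<close>

lemma cf_value_unique:
  assumes "\<forall>x\<in>set as. 0 < x" "as \<noteq> []" "\<forall>x\<in>set bs. 0 < x" "bs \<noteq> []"
    and "even (length as) = even (length bs)" and "cf_value as = cf_value bs"
  shows "as = bs"
  using assms
proof (induction as arbitrary: bs)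
  case (Cons a as)
  obtain b bs' where bs: "bs = b # bs'" using Cons.prems by (cases bs) auto
  have int_neq: "of_nat p \<noteq> of_nat q + 1 / v" if "1 < v" for p q and v :: rat
  proof
    assume eq: "of_nat p = of_nat q + 1 / v"
    have "0 < 1 / v" "1 / v < 1" using that by auto
    then have "(of_nat q :: rat) < of_nat p" "(of_nat p :: rat) < of_nat (q + 1)"
      using eq by auto
    then show False unfolding of_nat_less_iff by simp
  qed
  show ?case
  proof (cases as)
    case Nil
    show ?thesis
    proof (cases bs')
      case (Cons c cs)
      \<comment> \<open>By parity \<open>bs\<close> has at least three entries, so its tail has value above one and \<open>bs\<close>
        does not have an integral value.\<close>
      then obtain e es where "cs = e # es"
        using Cons.prems(5) Nil bs by (cases cs) auto
      then have "1 < cf_value bs'" using cf_value_gt_1[of c e es] Cons Cons.prems(3) bs by simp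
      then show ?thesis using int_neq[of "cf_value bs'" a b] Cons.prems(6) Nil bs Cons by simp
    qed (use Cons.prems Nil bs in simp)
  next
    case as: (Cons c cs)
    show ?thesis
    proof (cases bs')
      case Nil
      then obtain e es where "cs = e # es"
        using Cons.prems(5) as bs by (cases cs) auto
      then have "1 < cf_value as" using cf_value_gt_1[of c e es] as Cons.prems(1) by simp
      then show ?thesis using int_neq[of "cf_value as" b a] Cons.prems(6) Nil bs as by simp
    next
      case bs': (Cons e es)
      have v: "1 \<le> cf_value as" "1 \<le> cf_value bs'"
        using Cons.prems as bs bs' by (auto intro!: cf_value_ge_1)
      then have u: "0 < 1 / cf_value as" "1 / cf_value as \<le> 1"
          "0 < 1 / cf_value bs'" "1 / cf_value bs' \<le> 1"
        by auto
      have eq: "of_nat a + 1 / cf_value as = of_nat b + 1 / cf_value bs'"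
        using Cons.prems(6) as bs bs' by simp
      then have "(of_nat a :: rat) < of_nat (b + 1)" "(of_nat b :: rat) < of_nat (a + 1)"
        using u by (simp_all only: of_nat_add of_nat_1; linarith)+
      then have "a = b" unfolding of_nat_less_iff by simp
      then have "cf_value as = cf_value bs'" using eq v by (simp add: field_simps)
      then have "as = bs'"
        using Cons.prems as bs bs' by (intro Cons.IH) auto
      then show ?thesis using \<open>a = b\<close> bs by simp
    qed
  qed
qed simp

lemma regular_cf_exists:
  fixes P M :: nat
  assumes "0 < M" "M < P"
  shows "\<exists>as. as \<noteq> [] \<and> (\<forall>a\<in>set as. 0 < a) \<and> 1 < last as \<and>
    cf_value as = of_nat P / of_nat M"
  using assms
proof (induction M arbitrary: P rule: less_induct)
  case (less M)
  have P: "P = P div M * M + P mod M" by simp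
  have q: "(of_nat P :: rat) / of_nat M = of_nat (P div M) + of_nat (P mod M) / of_nat M"
  proof -
    have "(of_nat P :: rat) = of_nat (P div M) * of_nat M + of_nat (P mod M)"
      using P by (metis of_nat_add of_nat_mult)
    then show ?thesis using less.prems by (simp add: field_simps)
  qed
  have pos: "0 < P div M" using less.prems by (simp add: div_greater_zero_iff)
  show ?case
  proof (cases "P mod M = 0")
    case True
    then have "P div M \<noteq> 1" using P less.prems by auto
    then show ?thesis using True pos q by (intro exI[of _ "[P div M]"]) auto
  next
    case False
    then obtain as where as: "as \<noteq> []" "\<forall>a\<in>set as. 0 < a" "1 < last as"
        "cf_value as = of_nat M / of_nat (P mod M)"
      using less.IH[of "P mod M" M] less.prems by auto
    then have "cf_value (P div M # as) = of_nat (P div M) + 1 / cf_value as"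
      by (cases as) auto
    then show ?thesis using as pos q by (intro exI[of _ "P div M # as"]) auto
  qed
qed

lemma cf_value_split_last:
  assumes "\<forall>a\<in>set as. 0 < a" "as \<noteq> []" "1 < last as"
  shows "cf_value (butlast as @ [last as - 1, 1]) = cf_value as"
  using assms
proof (induction as)
  case (Cons a as)
  show ?case
  proof (cases as)
    case Nil
    then show ?thesis using Cons.prems by (simp add: of_nat_diff)
  next
    case (Cons b bs)
    obtain c cs where c: "butlast as @ [last as - 1, 1] = c # cs"
      by (cases "butlast as @ [last as - 1, 1]") auto
    have "cf_value (c # cs) = cf_value as"
      using Cons.IH Cons.prems Cons c by simp
    moreover have "butlast (a # as) @ [last (a # as) - 1, 1] = a # c # cs"
      using c Cons by simp
    ultimately show ?thesis using Cons by simp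
  qed
qed simp

lemma split_last_pos:
  assumes "\<forall>a\<in>set as. 0 < a" "1 < last as"
  shows "\<forall>a\<in>set (butlast as @ [last as - (1 :: nat), 1]). 0 < a"
  using assms by (auto dest: in_set_butlastD)

text \<open>If two regular expansions of the same number had lengths of different parity, splitting the
  last entry of one would make it equal to the other, whose last entry is not 1.\<close>

lemma regular_cf_properties:
  fixes P M :: nat
  assumes "0 < M" "M < P" "r = of_nat P / of_nat M"
  shows "regular_cf r \<noteq> [] \<and> (\<forall>a\<in>set (regular_cf r). 0 < a) \<and> 1 < last (regular_cf r) \<and>
    cf_value (regular_cf r) = r"
proof -
  let ?reg = "\<lambda>as. as \<noteq> [] \<and> (\<forall>a\<in>set as. 0 < a) \<and> 1 < last as \<and> cf_value as = r"
  have "as = bs" if as: "?reg as" and bs: "?reg bs" for as bs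
  proof (cases "even (length as) = even (length bs)")
    case True
    then show ?thesis using as bs by (intro cf_value_unique) auto
  next
    case False
    have "butlast as @ [last as - 1, 1] = bs"
    proof (rule cf_value_unique)
      show "\<forall>x\<in>set (butlast as @ [last as - 1, 1]). 0 < x"
        using as split_last_pos by blast
      show "cf_value (butlast as @ [last as - 1, 1]) = cf_value bs"
        using as bs cf_value_split_last by auto
      show "even (length (butlast as @ [last as - 1, 1])) = even (length bs)"
        using False as by (cases as) auto
    qed (use bs in auto)
    then have "last bs = 1" by (metis last_snoc append_Cons append_Nil append_assoc)
    then show ?thesis using bs by simp
  qed
  moreover have "\<exists>as. ?reg as" using regular_cf_exists assms by simp
  ultimately have "\<exists>!as. ?reg as" by blast
  then show ?thesis unfolding regular_cf_def by (rule theI')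
qed

lemma even_cf_properties:
  fixes P M :: nat
  assumes "0 < M" "M < P" "r = of_nat P / of_nat M"
  shows "even_cf r \<noteq> []" "\<forall>a\<in>set (even_cf r). 0 < a" "cf_value (even_cf r) = r"
    "even (length (even_cf r))"
  using regular_cf_properties[OF assms] split_last_pos[of "regular_cf r"]
    cf_value_split_last[of "regular_cf r"]
  by (auto simp: even_cf_def Let_def)

lemma odd_cf_properties:
  fixes P M :: nat
  assumes "0 < M" "M < P" "r = of_nat P / of_nat M"
  shows "odd_cf r \<noteq> []" "\<forall>a\<in>set (odd_cf r). 0 < a" "cf_value (odd_cf r) = r"
    "odd (length (odd_cf r))"
  using regular_cf_properties[OF assms] split_last_pos[of "regular_cf r"]
    cf_value_split_last[of "regular_cf r"]
  by (auto simp: odd_cf_def Let_def)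

section \<open>Palindromic expansions\<close>

lemma palindromic_iff_rev: "palindromic as \<longleftrightarrow> rev as = as"
proof -
  have "rev as = as \<longleftrightarrow> (\<forall>i < length as. rev as ! i = as ! i)"
    unfolding list_eq_iff_nth_eq by simp
  moreover have "rev as ! i = as ! (length as - 1 - i)" if "i < length as" for i
    using that by (simp add: rev_nth)
  ultimately show ?thesis unfolding palindromic_def by metis
qed

text \<open>With \<open>R\<close> the continuant of all entries but the last, the reversed list has value \<open>P / R\<close>,
  while \<open>M R \<equiv> - (-1)\<^sup>L\<close> modulo \<open>P\<close>. As \<open>M\<close> is invertible modulo \<open>P\<close> and \<open>M\<close> and \<open>R\<close> differ by
  less than \<open>P\<close>, the congruence \<open>M\<^sup>2 \<equiv> M R\<close> holds only if \<open>R = M\<close>. In that case the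
  list and its reversal have the same value and the same length, and so they are equal.\<close>

lemma palindromic_iff_dvd:
  fixes P M :: nat
  assumes pos: "\<forall>a\<in>set as. 0 < a" and ne: "as \<noteq> []"
    and cop: "coprime P M" and M: "0 < M" "M < P"
    and val: "cf_value as = of_nat P / of_nat M"
  shows "palindromic as \<longleftrightarrow> int P dvd (int M)\<^sup>2 + (-1) ^ length as"
proof -
  obtain a ys where as: "as = a # ys" using ne by (cases as) auto
  have "0 < continuant ys" using pos as by (intro continuant_pos) auto
  then have "(of_nat (continuant as * M) :: rat) = of_nat (P * continuant ys)"
    using val M cf_value_eq_continuant[of a ys] pos as by (simp add: field_simps)
  then have "continuant as * M = P * continuant ys" unfolding of_nat_eq_iff .
  then have PM: "P = continuant as" "M = continuant ys"
    using cop coprime_continuant[of a ys] as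
    by (metis coprime_commute coprime_crossproduct_nat mult.commute)+
  show ?thesis
  proof (cases ys rule: rev_cases)
    case Nil
    then show ?thesis using as PM by (simp add: palindromic_def)
  next
    case (snoc xs b)
    define R where "R = continuant (a # xs)"
    have R_rev: "R = continuant (rev xs @ [a])"
      using continuant_rev[of "a # xs"] by (simp add: R_def)
    have rev_as: "rev as = b # rev xs @ [a]" using as snoc by simp
    have "R \<le> P"
      using continuant_le_Cons[of b "rev xs @ [a]"] continuant_rev[of as] pos
      unfolding rev_as PM R_rev as snoc by simp
    have det: "int P * int (continuant xs) - int R * int M = (-1) ^ length as"
      using continuant_det[of a xs b] unfolding R_def PM as snoc by simp
    have pal: "palindromic as \<longleftrightarrow> R = M"
    proof
      assume "palindromic as"
      then have "b # rev xs @ [a] = a # ys"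
        unfolding palindromic_iff_rev using rev_as as by argo
      then show "R = M" unfolding R_rev PM by simp
    next
      assume "R = M"
      have "cf_value (rev as) = of_nat P / of_nat R"
        using cf_value_eq_continuant[of b "rev xs @ [a]"] continuant_rev[of as] pos
        unfolding rev_as PM R_rev as snoc by (simp add: ball_Un)
      then have "cf_value (rev as) = cf_value as" using \<open>R = M\<close> val by simp
      then have "rev as = as" using pos ne by (intro cf_value_unique) auto
      then show "palindromic as" by (simp add: palindromic_iff_rev)
    qed
    have "(int M)\<^sup>2 + (-1) ^ length as = int M * (int M - int R) + int P * int (continuant xs)"
      unfolding det[symmetric] by (simp add: power2_eq_square algebra_simps)
    then have "int P dvd (int M)\<^sup>2 + (-1) ^ length as \<longleftrightarrow> int P dvd int M * (int M - int R)"
      by (simp add: dvd_add_left_iff)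
    also have "\<dots> \<longleftrightarrow> int P dvd int M - int R"
      using cop by (simp add: coprime_dvd_mult_right_iff)
    also have "\<dots> \<longleftrightarrow> R = M"
    proof
      assume d: "int P dvd int M - int R"
      have "\<bar>int M - int R\<bar> < int P" using M \<open>R \<le> P\<close> by auto
      then show "R = M" using dvd_imp_le_int[OF _ d] by linarith
    qed simp
    finally show ?thesis using pal by simp
  qed
qed

lemma palindromic_even_cf_iff:
  fixes P M :: nat
  assumes "coprime P M" "0 < M" "M < P" "r = of_nat P / of_nat M"
  shows "palindromic (even_cf r) \<longleftrightarrow> int P dvd (int M)\<^sup>2 + 1"
  using palindromic_iff_dvd[of "even_cf r" P M] even_cf_properties[of M P r] assms by simp

lemma palindromic_odd_cf_iff:
  fixes P M :: nat
  assumes "coprime P M" "0 < M" "M < P" "r = of_nat P / of_nat M"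
  shows "palindromic (odd_cf r) \<longleftrightarrow> int P dvd (int M)\<^sup>2 - 1"
  using palindromic_iff_dvd[of "odd_cf r" P M] odd_cf_properties[of M P r] assms by simp

section \<open>Symmetry types of the classes\<close>

theorem theorem3p14:
  fixes m k :: int
  assumes "0 \<le> m" and "m < \<bar>k\<bar>"
  shows "disc (m, 0, k) = k\<^sup>2
    \<and> (supersymmetric (form_class (m, 0, k)) \<longleftrightarrow> m = 0 \<or> even k \<and> m = \<bar>k\<bar> div 2)
    \<and> (even k \<and> m = \<bar>k\<bar> div 2 \<longrightarrow> 4 dvd disc (m, 0, k))
    \<and> (m \<noteq> 0 \<and> 2 * m \<noteq> \<bar>k\<bar> \<longrightarrow>
        (mn_symmetric (form_class (m, 0, k)) \<longleftrightarrow>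
          palindromic (even_cf (of_int \<bar>k\<bar> / of_int m))))
    \<and> (m \<noteq> 0 \<and> 2 * m \<noteq> \<bar>k\<bar> \<longrightarrow>
        (k_symmetric (form_class (m, 0, k)) \<longleftrightarrow>
          palindromic (odd_cf (of_int \<bar>k\<bar> / of_int m))))
    \<and> \<not> antisymmetric (form_class (m, 0, k))
    \<and> (m \<noteq> 0 \<longrightarrow>
        (asymmetric (form_class (m, 0, k)) \<longleftrightarrow>
          \<not> palindromic (odd_cf (of_int \<bar>k\<bar> / of_int m)) \<and>
          \<not> palindromic (even_cf (of_int \<bar>k\<bar> / of_int m))))"
proof -
  have k: "k \<noteq> 0" using assms by auto
  obtain g M P where g: "g > 0" and m: "m = g * M" and kP: "k = g * P" and cop: "coprime M P"
  proof
    show "gcd m k > 0" using k by simp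
    show "coprime (m div gcd m k) (k div gcd m k)" using k by (intro div_gcd_coprime) auto
  qed auto
  have gn: "g \<noteq> 0" and Pn: "P \<noteq> 0" using g kP k by auto
  have absk: "\<bar>k\<bar> = g * \<bar>P\<bar>" using g kP by (simp add: abs_mult)
  have M0: "0 \<le> M" using assms(1) m g by (simp add: zero_le_mult_iff)
  have MP: "M < \<bar>P\<bar>" using assms(2) m absk g by simp
  have conj: "invariant_under conjugate (form_class (m, 0, k)) \<longleftrightarrow> P dvd M\<^sup>2 - 1"
    using invariant_conjugate_iff[OF cop gn Pn] m kP by simp
  have adj: "invariant_under adjoint (form_class (m, 0, k)) \<longleftrightarrow> P dvd M\<^sup>2 + 1"
    using invariant_adjoint_iff[OF cop gn Pn] m kP by simp
  have anti: "invariant_under antipodal (form_class (m, 0, k)) \<longleftrightarrow> P dvd 2"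
    using invariant_antipodal_iff[OF cop gn Pn] m kP by simp
  have special: "P dvd 2 \<longleftrightarrow> m = 0 \<or> 2 * m = \<bar>k\<bar>"
  proof
    assume "P dvd 2"
    then have "\<bar>P\<bar> \<le> 2" using zdvd_imp_le[of "\<bar>P\<bar>" 2] by simp
    then consider "\<bar>P\<bar> = 1" | "\<bar>P\<bar> = 2" using Pn by linarith
    then show "m = 0 \<or> 2 * m = \<bar>k\<bar>"
    proof cases
      case 1
      then show ?thesis using M0 MP m by auto
    next
      case 2
      then have "M = 0 \<or> M = 1" using M0 MP by auto
      then show ?thesis using m absk 2 by auto
    qed
  next
    assume "m = 0 \<or> 2 * m = \<bar>k\<bar>"
    then have "P dvd 2 * M"
    proof
      assume "2 * m = \<bar>k\<bar>"
      then have "2 * M = \<bar>P\<bar>" using m absk g by auto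
      then show ?thesis by simp
    qed (use m g in simp)
    then show "P dvd 2" using cop by (simp add: coprime_commute coprime_dvd_mult_left_iff)
  qed
  have both: "P dvd 2" if "P dvd M\<^sup>2 - 1" "P dvd M\<^sup>2 + 1"
    using dvd_diff[OF that(2,1)] by simp
  have all: "P dvd M\<^sup>2 - 1 \<and> P dvd M\<^sup>2 + 1" if P2: "P dvd 2"
  proof -
    have sum: "M\<^sup>2 + 1 = (M\<^sup>2 - 1) + 2" by simp
    have "P dvd M\<^sup>2 - 1"
    proof (cases "even M")
      case True
      \<comment> \<open>Then \<open>P\<close> divides both 2 and \<open>M\<close>, so it is a unit.\<close>
      then have "P dvd M" using P2 dvd_trans by blast
      then have "P dvd 1" using cop by (metis coprime_common_divisor dvd_refl)
      then show ?thesis using dvd_trans one_dvd by blast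
    next
      case False
      then have "even (M\<^sup>2 - 1)" by simp
      then show ?thesis using P2 dvd_trans by blast
    qed
    then show ?thesis using P2 sum by (metis dvd_add)
  qed
  have half: "even k \<and> m = \<bar>k\<bar> div 2 \<longleftrightarrow> 2 * m = \<bar>k\<bar>"
  proof -
    have "even k" if "2 * m = \<bar>k\<bar>" using that by (metis dvd_abs_iff dvd_triv_left)
    then show ?thesis by auto
  qed
  have four: "4 dvd disc (m, 0, k)" if "even k"
    using that by (auto simp: power2_eq_square elim!: evenE)
  have pal: "palindromic (even_cf (of_int \<bar>k\<bar> / of_int m)) \<longleftrightarrow> P dvd M\<^sup>2 + 1"
    "palindromic (odd_cf (of_int \<bar>k\<bar> / of_int m)) \<longleftrightarrow> P dvd M\<^sup>2 - 1" if "m \<noteq> 0"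
  proof -
    have r: "(of_int \<bar>k\<bar> / of_int m :: rat) = of_nat (nat \<bar>P\<bar>) / of_nat (nat M)"
      using g M0 unfolding absk m by simp
    have c: "coprime (nat \<bar>P\<bar>) (nat M)"
      using cop M0 by (metis abs_of_nonneg coprime_commute coprime_abs_left_iff coprime_int_iff
          int_nat_eq abs_ge_zero)
    have "0 < nat M" "nat M < nat \<bar>P\<bar>" using M0 MP that m by auto
    from palindromic_even_cf_iff[OF c this r] palindromic_odd_cf_iff[OF c this r]
    show "palindromic (even_cf (of_int \<bar>k\<bar> / of_int m)) \<longleftrightarrow> P dvd M\<^sup>2 + 1"
      "palindromic (odd_cf (of_int \<bar>k\<bar> / of_int m)) \<longleftrightarrow> P dvd M\<^sup>2 - 1"
      using M0 by simp_all
  qed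
  have "disc (m, 0, k) = k\<^sup>2" by simp
  moreover have "2 * m = \<bar>k\<bar> \<longrightarrow> 4 dvd disc (m, 0, k)" using half four by blast
  ultimately show ?thesis
    unfolding supersymmetric_def mn_symmetric_def k_symmetric_def antisymmetric_def
      asymmetric_def conj adj anti half
    using special both all pal by metis
qed

end
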